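(* Let $m,n\ge 1$ be odd integers, $m=2\mu+1$, $n=2\nu+1$. Define the toric information quantity $$Q^{T}_{(m,n)}=\sum_{i=1}^m\sum_{j=1}^n S\big(A_i^{(\mu+1)}B_j^{(\nu)}\big)-\sum_{i=1}^m\sum_{j=1}^n S\big(A_i^{(\mu)}B_j^{(\nu)}\big)-S(A_1A_2\cdots A_m).$$ Then $Q^T_{(m,n)}$ is TF-compatible (with $B_n$ as the purifier), and explicitly $$\begin{aligned}Q^T_{(m,n)}=&-\sum_{i=1}^{m}\sum_{k=1}^{\nu} I_3\big(A_i : B_{\nu+k} : B_k^{(\nu-k+1)}\,\big|\,A_{i+1}^{(\mu)}B_{\nu+1}^{(k-1)}\big)\\&-\sum_{i=1}^{\mu}\sum_{j=1}^{i} I_3\big(A_{\mu+j}:A_i:A_{\mu+i+1}^{(\mu-i+1)}\,\big|\,A_{i+1}^{(\mu-i)}A_{\mu+j+1}^{(i-j)}\big)\\&-\sum_{j=2}^{\mu} I_3\big(A_{\mu+j}:A_j^{(\mu-j+1)}:A_1^{(j-1)}\,\big|\,A_{\mu+j+1}^{(\mu-j+1)}\big).\end{aligned}$$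
   Context: The parties are $m+n$ distinct elements $A_1,\dots,A_m,B_1,\dots,B_n$. A subsystem is a subset of the set of parties; juxtaposition denotes union. $S$ is an arbitrary real-valued function on subsystems with $S(\emptyset)=0$ and satisfying purity: $S(X)=S(\overline X)$, where $\overline X$ is the complement of $X$ in the set of all $m+n$ parties. All identities are understood to hold for every such $S$. One party is designated as the purifier ($B_n$ here); by purity, every entropy can be written as the entropy of a subset of the remaining $\mathsf N=m+n-1$ parties. Indices are cyclic: $A_{i+m}=A_i$, $B_{j+n}=B_j$. For $k\ge 0$, $A_i^{(k)}=A_iA_{i+1}\cdots A_{i+k-1}$ and $B_j^{(k)}=B_jB_{j+1}\cdots B_{j+k-1}$ (empty if $k=0$). Sums with empty range are $0$. For pairwise disjoint subsystems $X,Y,Z,W$, the conditional tripartite information is $$I_3(X:Y:Z\,|\,W)=S(XW)+S(YW)+S(ZW)+S(XYZW)-S(XYW)-S(XZW)-S(YZW)-S(W),$$ and $I_3(X:Y:Z)=I_3(X:Y:Z\,|\,\emptyset)$. An information quantity (linear combination of entropies) is TF-compatible if it can be written as a finite sum $\sum_i -I_3(X_i:Y_i:Z_i\,|\,W_i)$ where, for each $i$, $X_i,Y_i,Z_i,W_i$ are pairwise disjoint subsystems not containing the purifier ($W_i=\emptyset$ allowed; repetition of terms allowed). *)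

theory Defs
  imports Complex_Main
begin

(* Parties are labelled from 1, so the labels of the m + n parties are A 1, ..., A m, B 1, ..., B n.
   A and B are later assumed to be periodic, with periods m and n. *)

definition parties :: "(nat \<Rightarrow> 'p) \<Rightarrow> nat \<Rightarrow> (nat \<Rightarrow> 'p) \<Rightarrow> nat \<Rightarrow> 'p set" where
  "parties A m B n = A ` {1..m} \<union> B ` {1..n}"

(* block A i k is the subsystem A i, A (i + 1), ..., A (i + k - 1). *)

definition block :: "(nat \<Rightarrow> 'p) \<Rightarrow> nat \<Rightarrow> nat \<Rightarrow> 'p set" where
  "block A i k = A ` {i..<i + k}"

(* The values of S on sets that are not subsystems, i.e. not contained in P, are unconstrained. *)

definition pure_entropy :: "'p set \<Rightarrow> ('p set \<Rightarrow> real) \<Rightarrow> bool" where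
  "pure_entropy P S \<longleftrightarrow> S {} = 0 \<and> (\<forall>X. X \<subseteq> P \<longrightarrow> S X = S (P - X))"

(* I3 S X Y Z W is the conditional tripartite information I_3(X : Y : Z | W) with respect to S.
   It is meant for pairwise disjoint arguments only; see TF_admissible. *)

definition I3 :: "('p set \<Rightarrow> real) \<Rightarrow> 'p set \<Rightarrow> 'p set \<Rightarrow> 'p set \<Rightarrow> 'p set \<Rightarrow> real" where
  "I3 S X Y Z W =
     S (X \<union> W) + S (Y \<union> W) + S (Z \<union> W) + S (X \<union> Y \<union> Z \<union> W)
     - S (X \<union> Y \<union> W) - S (X \<union> Z \<union> W) - S (Y \<union> Z \<union> W) - S W"

(* The six disjointness conditions are spelled out because pairwise disjointness of the set
   {X, Y, Z, W} would not exclude that two of the arguments coincide. *)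

definition TF_admissible :: "'p set \<Rightarrow> 'p \<Rightarrow> 'p set \<Rightarrow> 'p set \<Rightarrow> 'p set \<Rightarrow> 'p set \<Rightarrow> bool" where
  "TF_admissible P p X Y Z W \<longleftrightarrow>
     X \<subseteq> P - {p} \<and> Y \<subseteq> P - {p} \<and> Z \<subseteq> P - {p} \<and> W \<subseteq> P - {p} \<and>
     X \<inter> Y = {} \<and> X \<inter> Z = {} \<and> X \<inter> W = {} \<and>
     Y \<inter> Z = {} \<and> Y \<inter> W = {} \<and> Z \<inter> W = {}"

(* An information quantity is a functional Q of the entropy function S; two quantities are
   identified if they agree for every S satisfying pure_entropy P. The decomposition ts is chosen
   before S, and it is a list so that terms may be repeated. Being a linear combination
   of entropies is a consequence of the existence of such a decomposition. *)

definition TF_compatible :: "'p set \<Rightarrow> 'p \<Rightarrow> (('p set \<Rightarrow> real) \<Rightarrow> real) \<Rightarrow> bool" where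
  "TF_compatible P p Q \<longleftrightarrow>
     (\<exists>ts :: ('p set \<times> 'p set \<times> 'p set \<times> 'p set) list.
        (\<forall>(X, Y, Z, W) \<in> set ts. TF_admissible P p X Y Z W) \<and>
        (\<forall>S. pure_entropy P S \<longrightarrow> Q S = (\<Sum>(X, Y, Z, W) \<leftarrow> ts. - I3 S X Y Z W)))"

(* For odd m and n, m div 2 and n div 2 are the numbers mu and nu with m = 2 mu + 1, n = 2 nu + 1. *)

definition toric_Q ::
  "(nat \<Rightarrow> 'p) \<Rightarrow> nat \<Rightarrow> (nat \<Rightarrow> 'p) \<Rightarrow> nat \<Rightarrow> ('p set \<Rightarrow> real) \<Rightarrow> real" where
  "toric_Q A m B n S =
     (\<Sum>i=1..m. \<Sum>j=1..n. S (block A i (m div 2 + 1) \<union> block B j (n div 2)))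
     - (\<Sum>i=1..m. \<Sum>j=1..n. S (block A i (m div 2) \<union> block B j (n div 2)))
     - S (block A 1 m)"

end

(* Summing the first family over k telescopes. Purity turns S(A_i^(k) B_j^(nu+1)) into
   S(A_(i+k)^(m-k) B_(j+nu+1)^(nu)), so that after summing over the cyclic index i the remaining
   terms complete the two double sums of Q, up to the terms S(A_i^(mu+1)) - S(A_i^(mu)).
   These are produced by the other two families for an arbitrary S with S({}) = 0, without purity:
   in terms of the entropies h i j of A_i ... A_mu A_(mu+j) ... A_m, the second family telescopes
   in j and then in i, and the third family cancels the diagonal terms left over and supplies the
   blocks that wrap around A_m. *)

theory Submission
  imports Defs
begin

subsection \<open>Blocks and cyclic labellings\<close>

lemma block_add: "block A i k \<union> block A (i + k) l = block A i (k + l)"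
  unfolding block_def image_Un[symmetric] by (rule arg_cong[of _ _ "image A"]) auto

lemma insert_block: "insert (A i) (block A (i + 1) k) = block A i (k + 1)"
  using block_add[of A i 1 k] by (simp add: block_def add.commute)

lemma insert_block_end: "insert (A (i + k)) (block A i k) = block A i (k + 1)"
  using block_add[of A i k 1] by (simp add: block_def)

locale cyclic_labelling =
  fixes A :: "nat \<Rightarrow> 'p" and m :: nat
  assumes pos: "m > 0"
    and inj: "inj_on A {1..m}"
    and periodic: "A (i + m) = A i"
begin

lemma block_shift: "block A (i + m) k = block A i k"
proof -
  have "block A (i + m) k = A ` (\<lambda>x. x + m) ` {i..<i + k}"
    unfolding block_def by (simp add: ac_simps)
  also have "\<dots> = block A i k"
    unfolding image_image periodic block_def ..
  finally show ?thesis .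
qed

text \<open>Moving a window of length \<open>m\<close> one step drops \<open>A i\<close> and adds
  \<open>A (i + m)\<close>, which is the same party.\<close>

lemma block_full: "block A i m = A ` {1..m}"
proof -
  have step: "block A (i + 1) m = block A i m" for i
    using insert_block[of A i "m - 1"] insert_block_end[of A "i + 1" "m - 1"] pos periodic[of i]
    by (simp add: ac_simps)
  have "block A i m = block A 0 m" for i
    by (induction i) (use step in simp_all)
  moreover have "block A 1 m = A ` {1..m}"
    unfolding block_def by (rule arg_cong[of _ _ "image A"]) auto
  ultimately show ?thesis by metis
qed

text \<open>By \<open>block_full\<close> the image of the window has \<open>m\<close> elements, like
  the window itself, and this forces injectivity on a finite set.\<close>

lemma inj_on_window: "inj_on A {i..<i + m}"
proof (rule eq_card_imp_inj_on)
  show "card (A ` {i..<i + m}) = card {i..<i + m}"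
    using block_full[of i] card_image[OF inj] by (simp add: block_def)
qed simp

lemma block_subset: "k \<le> m \<Longrightarrow> block A i k \<subseteq> A ` {1..m}"
  using block_full[of i] by (auto simp: block_def)

lemma block_disjoint: "k + l \<le> m \<Longrightarrow> block A i k \<inter> block A (i + k) l = {}"
  using inj_on_image_Int[OF inj_on_window[of i], of "{i..<i + k}" "{i + k..<i + k + l}"]
  by (force simp: block_def)

text \<open>On a cycle the complement of an arc is the arc that follows it, so purity turns blocks
  into blocks.\<close>

lemma block_compl:
  assumes "k \<le> m"
  shows "A ` {1..m} - block A i k = block A (i + k) (m - k)"
  using block_add[of A i k "m - k"] block_disjoint[of k "m - k" i] assms block_full[of i] by auto

text \<open>Each unit shift changes the sum by \<open>f (m + 1 + c) - f (1 + c)\<close>, which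
  vanishes by periodicity.\<close>

lemma sum_shift:
  fixes f :: "nat \<Rightarrow> real"
  assumes "\<And>i. f (i + m) = f i"
  shows "(\<Sum>i=1..m. f (i + c)) = (\<Sum>i=1..m. f i)"
proof (induction c)
  case (Suc c)
  have "(\<Sum>i=1..m. f (i + Suc c) - f (i + c)) = f (m + 1 + c) - f (1 + c)"
    using sum_Suc_diff[of 1 m "\<lambda>i. f (i + c)"] by simp
  then show ?case
    using Suc assms[of "1 + c"] by (simp add: sum_subtractf ac_simps)
qed simp

end

subsection \<open>Closure of TF-compatibility under sums\<close>

lemma TF_compatible_I3:
  "TF_admissible P p X Y Z W \<Longrightarrow> TF_compatible P p (\<lambda>S. - I3 S X Y Z W)"
  unfolding TF_compatible_def by (rule exI[of _ "[(X, Y, Z, W)]"]) simp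

lemma TF_compatible_add:
  assumes "TF_compatible P p Q" "TF_compatible P p R"
  shows "TF_compatible P p (\<lambda>S. Q S + R S)"
proof -
  obtain ts us where "\<forall>(X, Y, Z, W) \<in> set ts. TF_admissible P p X Y Z W"
    "\<forall>S. pure_entropy P S \<longrightarrow> Q S = (\<Sum>(X, Y, Z, W) \<leftarrow> ts. - I3 S X Y Z W)"
    "\<forall>(X, Y, Z, W) \<in> set us. TF_admissible P p X Y Z W"
    "\<forall>S. pure_entropy P S \<longrightarrow> R S = (\<Sum>(X, Y, Z, W) \<leftarrow> us. - I3 S X Y Z W)"
    using assms unfolding TF_compatible_def by metis
  then show ?thesis
    unfolding TF_compatible_def by (intro exI[of _ "ts @ us"]) auto
qed

lemma TF_compatible_sum:
  assumes "\<And>i. i \<in> I \<Longrightarrow> TF_compatible P p (Q i)"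
  shows "TF_compatible P p (\<lambda>S. \<Sum>i\<in>I. Q i S)"
proof -
  \<comment> \<open>The empty decomposition covers both an empty \<open>I\<close> and an infinite
    \<open>I\<close>, whose sum is 0 by convention.\<close>
  have zero: "TF_compatible P p (\<lambda>S. 0)"
    unfolding TF_compatible_def by (rule exI[of _ "[]"]) simp
  show ?thesis using assms
    by (induction I rule: infinite_finite_induct) (simp_all add: zero TF_compatible_add)
qed

lemma TF_compatible_cong:
  assumes "TF_compatible P p R" "\<And>S. pure_entropy P S \<Longrightarrow> Q S = R S"
  shows "TF_compatible P p Q"
  using assms unfolding TF_compatible_def by simp

text \<open>Lets the entropy identities among the parties \<open>A\<close> be computed with
  intervals of labels.\<close>

lemma I3_image:
  "I3 S (A ` X) (A ` Y) (A ` Z) (A ` W) = I3 (\<lambda>I. S (A ` I)) X Y Z W"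
  unfolding I3_def image_Un by simp

lemma TF_admissible_image:
  assumes "inj_on A D" "X \<union> Y \<union> Z \<union> W \<subseteq> D" "A ` D \<subseteq> P - {p}"
    and "X \<inter> Y = {}" "X \<inter> Z = {}" "X \<inter> W = {}" "Y \<inter> Z = {}" "Y \<inter> W = {}" "Z \<inter> W = {}"
  shows "TF_admissible P p (A ` X) (A ` Y) (A ` Z) (A ` W)"
proof -
  have "A ` U \<inter> A ` V = {}" if "U \<subseteq> D" "V \<subseteq> D" "U \<inter> V = {}" for U V
    using inj_on_image_Int[OF assms(1) that(1,2)] that(3) by simp
  moreover have "A ` U \<subseteq> P - {p}" if "U \<subseteq> D" for U
    using image_mono[OF that, of A] assms(3) by blast
  ultimately show ?thesis
    using assms(2,4-) unfolding TF_admissible_def by simp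
qed

text \<open>Serves the first family: \<open>Y\<close>, \<open>Z\<close>, \<open>W\<close> live among
  the parties \<open>B\<close>, while \<open>x\<close> and \<open>a\<close> come from the parties
  \<open>A\<close>. The empty first slot is the place reserved for \<open>x\<close>.\<close>

lemma TF_admissible_extend:
  assumes "TF_admissible Q p {} Y Z W" "insert x a \<subseteq> R" "x \<notin> a" "R \<inter> Q = {}" "p \<notin> R"
  shows "TF_admissible (R \<union> Q) p {x} Y Z (a \<union> W)"
  using assms unfolding TF_admissible_def by (intro conjI) blast+

subsection \<open>The terms involving the parties \<open>B\<close>\<close>

text \<open>Four of the eight entropies in \<open>I3\<close> contain \<open>x\<close>; the other
  four are the same expression without \<open>x\<close>, with opposite sign. Each summand is
  therefore a difference of one function \<open>d\<close> at \<open>insert x a\<close> and at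
  \<open>a\<close>.\<close>

lemma sum_I3_B:
  fixes S :: "'p set \<Rightarrow> real" and B :: "nat \<Rightarrow> 'p" and \<nu> :: nat
  defines "g \<equiv> \<lambda>a. S (a \<union> block B (\<nu> + 1) \<nu>) - S a
    + (\<Sum>k=1..\<nu>. S (a \<union> block B k \<nu>) - S (a \<union> block B k (\<nu> + 1)))"
  shows "- (\<Sum>k=1..\<nu>. I3 S {x} {B (\<nu> + k)} (block B k (\<nu> - k + 1)) (a \<union> block B (\<nu> + 1) (k - 1)))
    = g (insert x a) - g a"
proof -
  define t where "t a k = S (a \<union> block B (\<nu> + 1) k)" for a k
  \<comment> \<open>For \<open>k \<ge> 1\<close> the argument \<open>Suc (k - 1)\<close> is
    \<open>k\<close>, so the first difference is an increment of \<open>t a\<close> and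
    telescopes.\<close>
  define d where "d a k = t a (Suc (k - 1)) - t a (k - 1)
    + (S (a \<union> block B k \<nu>) - S (a \<union> block B k (\<nu> + 1)))" for a k
  have *: "- I3 S {x} {B (\<nu> + k)} (block B k (\<nu> - k + 1)) (a \<union> block B (\<nu> + 1) (k - 1))
    = d (insert x a) k - d a k" if "k \<in> {1..\<nu>}" for k
  proof -
    let ?W = "block B (\<nu> + 1) (k - 1)" and ?Z = "block B k (\<nu> - k + 1)" and ?y = "B (\<nu> + k)"
    have Y: "insert ?y ?W = block B (\<nu> + 1) k"
      using insert_block_end[of B "\<nu> + 1" "k - 1"] that by simp
    have Z: "?Z \<union> ?W = block B k \<nu>"
      using block_add[of B k "\<nu> - k + 1" "k - 1"] that by simp
    have YZ: "insert ?y (block B k \<nu>) = block B k (\<nu> + 1)"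
      using insert_block_end[of B k \<nu>] by (simp add: add.commute)
    have sets: "{?y} \<union> (a \<union> ?W) = a \<union> block B (\<nu> + 1) k"
      "?Z \<union> (a \<union> ?W) = a \<union> block B k \<nu>"
      "{?y} \<union> ?Z \<union> (a \<union> ?W) = a \<union> block B k (\<nu> + 1)"
      "{x} \<union> (a \<union> ?W) = insert x a \<union> ?W"
      "{x} \<union> {?y} \<union> (a \<union> ?W) = insert x a \<union> block B (\<nu> + 1) k"
      "{x} \<union> ?Z \<union> (a \<union> ?W) = insert x a \<union> block B k \<nu>"
      "{x} \<union> {?y} \<union> ?Z \<union> (a \<union> ?W) = insert x a \<union> block B k (\<nu> + 1)"
      unfolding Y[symmetric] YZ[symmetric] Z[symmetric] by blast+
    show ?thesis
      unfolding I3_def sets d_def t_def using that by simp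
  qed
  have sum_d: "(\<Sum>k=1..\<nu>. d a k) = g a" for a
  proof -
    have "(\<Sum>k=1..\<nu>. t a (Suc (k - 1)) - t a (k - 1)) = t a \<nu> - t a 0"
      using sum_Suc_diff[of 1 \<nu> "\<lambda>k. t a (k - 1)"] by simp
    then show ?thesis
      unfolding d_def g_def sum.distrib by (simp add: t_def block_def)
  qed
  show ?thesis
    unfolding sum_negf[symmetric] sum_d[symmetric] sum_subtractf[symmetric]
    by (rule sum.cong[OF refl *])
qed

text \<open>The block lengths \<open>\<mu> + 1\<close> and \<open>\<mu>\<close> are complementary in
  \<open>m\<close>. Hence purity turns the negative terms with \<open>\<nu> + 1\<close> parties
  \<open>B\<close> at one length into the missing terms \<open>j > \<nu> + 1\<close> at the other
  length, with the right sign.\<close>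

lemma toric_B_part:
  fixes S :: "'p set \<Rightarrow> real"
  assumes m: "m = 2 * \<mu> + 1" and n: "n = 2 * \<nu> + 1"
    and "cyclic_labelling A m" "cyclic_labelling B n"
    and disj: "A ` {1..m} \<inter> B ` {1..n} = {}"
    and S: "pure_entropy (parties A m B n) S"
  shows "- (\<Sum>i=1..m. \<Sum>k=1..\<nu>. I3 S {A i} {B (\<nu> + k)} (block B k (\<nu> - k + 1))
            (block A (i + 1) \<mu> \<union> block B (\<nu> + 1) (k - 1)))
    = (\<Sum>i=1..m. \<Sum>j=1..n. S (block A i (\<mu> + 1) \<union> block B j \<nu>))
      - (\<Sum>i=1..m. \<Sum>j=1..n. S (block A i \<mu> \<union> block B j \<nu>))
      - ((\<Sum>i=1..m. S (block A i (\<mu> + 1))) - (\<Sum>i=1..m. S (block A i \<mu>)))"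
    (is "?L = _")
proof -
  interpret A: cyclic_labelling A m by fact
  interpret B: cyclic_labelling B n by fact
  define T where "T k j = (\<Sum>i=1..m. S (block A i k \<union> block B j \<nu>))" for k j
  define T0 where "T0 k = (\<Sum>i=1..m. S (block A i k))" for k
  have shift: "(\<Sum>i=1..m. S (block A (i + c) k \<union> X)) = (\<Sum>i=1..m. S (block A i k \<union> X))" for c k X
    by (rule A.sum_shift) (simp add: A.block_shift)
  have pure: "S (block A i k \<union> block B j (\<nu> + 1)) = S (block A (i + k) (m - k) \<union> block B (j + \<nu> + 1) \<nu>)"
    if "k \<le> m" for i j k
  proof -
    have "parties A m B n - (block A i k \<union> block B j (\<nu> + 1))
      = (A ` {1..m} - block A i k) \<union> (B ` {1..n} - block B j (\<nu> + 1))"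
      using A.block_subset[OF that, of i] B.block_subset[of "\<nu> + 1" j] disj n
      unfolding parties_def by auto
    also have "\<dots> = block A (i + k) (m - k) \<union> block B (j + \<nu> + 1) \<nu>"
      using A.block_compl[OF that] B.block_compl[of "\<nu> + 1" j] n by (simp add: ac_simps)
    finally have "parties A m B n - (block A i k \<union> block B j (\<nu> + 1)) = \<dots>" .
    moreover have "block A i k \<union> block B j (\<nu> + 1) \<subseteq> parties A m B n"
      using A.block_subset[OF that, of i] B.block_subset[of "\<nu> + 1" j] n
      unfolding parties_def by auto
    ultimately show ?thesis
      using S unfolding pure_entropy_def by metis
  qed
  \<comment> \<open>Purity moves the start of the \<open>A\<close> block from \<open>i\<close> to
    \<open>i + k\<close>; summing over the whole cycle removes this offset.\<close>
  have compl: "(\<Sum>i=1..m. S (block A i k \<union> block B j (\<nu> + 1))) = T (m - k) (j + \<nu> + 1)"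
    if "k \<le> m" for j k
    unfolding T_def pure[OF that] by (rule shift)
  define g where "g a = S (a \<union> block B (\<nu> + 1) \<nu>) - S a
    + (\<Sum>k=1..\<nu>. S (a \<union> block B k \<nu>) - S (a \<union> block B k (\<nu> + 1)))" for a
  have sum_g: "(\<Sum>i=1..m. g (block A i k))
      = T k (\<nu> + 1) - T0 k + (\<Sum>j=1..\<nu>. T k j - T (m - k) (j + \<nu> + 1))" if "k \<le> m" for k
  proof -
    have "(\<Sum>i=1..m. \<Sum>j=1..\<nu>. S (block A i k \<union> block B j \<nu>)) = (\<Sum>j=1..\<nu>. T k j)"
      unfolding T_def by (rule sum.swap)
    moreover have "(\<Sum>i=1..m. \<Sum>j=1..\<nu>. S (block A i k \<union> block B j (\<nu> + 1)))
      = (\<Sum>j=1..\<nu>. T (m - k) (j + \<nu> + 1))"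
      unfolding compl[OF that, symmetric] by (rule sum.swap)
    ultimately show ?thesis
      unfolding g_def sum.distrib sum_subtractf by (simp only: T_def T0_def)
  qed
  have g_shift: "(\<Sum>i=1..m. g (block A (i + 1) \<mu>)) = (\<Sum>i=1..m. g (block A i \<mu>))"
    by (rule A.sum_shift) (simp add: A.block_shift)
  \<comment> \<open>The three ranges have different sources: direct terms, the upper end of the
    telescope at \<open>j = \<nu> + 1\<close>, and terms obtained by purity.\<close>
  have split: "(\<Sum>j=1..n. T k j) = (\<Sum>j=1..\<nu>. T k j) + T k (\<nu> + 1) + (\<Sum>j=1..\<nu>. T k (j + \<nu> + 1))" for k
  proof -
    have "{1..n} = {1..\<nu>} \<union> {\<nu> + 1} \<union> {1 + (\<nu> + 1)..\<nu> + (\<nu> + 1)}" using n by auto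
    moreover have "(\<Sum>j\<in>{1 + (\<nu> + 1)..\<nu> + (\<nu> + 1)}. T k j) = (\<Sum>j=1..\<nu>. T k (j + \<nu> + 1))"
      by (subst sum.shift_bounds_cl_nat_ivl) (simp add: add.assoc)
    ultimately show ?thesis
      by (simp add: sum.union_disjoint)
  qed
  have "?L = (\<Sum>i=1..m. g (block A i (\<mu> + 1)) - g (block A (i + 1) \<mu>))"
  proof -
    have "- (\<Sum>k=1..\<nu>. I3 S {A i} {B (\<nu> + k)} (block B k (\<nu> - k + 1))
        (block A (i + 1) \<mu> \<union> block B (\<nu> + 1) (k - 1)))
      = g (block A i (\<mu> + 1)) - g (block A (i + 1) \<mu>)" for i
      unfolding g_def insert_block[of A i \<mu>, symmetric] by (rule sum_I3_B)
    then show ?thesis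
      unfolding sum_negf[symmetric, of _ "{1..m}"] by simp
  qed
  also have "\<dots> = (\<Sum>i=1..m. g (block A i (\<mu> + 1))) - (\<Sum>i=1..m. g (block A i \<mu>))"
    by (simp only: sum_subtractf g_shift)
  also have "\<dots> = (\<Sum>j=1..n. T (\<mu> + 1) j) - (\<Sum>j=1..n. T \<mu> j) - (T0 (\<mu> + 1) - T0 \<mu>)"
    unfolding split using sum_g[of "\<mu> + 1"] sum_g[of \<mu>] m
    by (simp add: sum_subtractf del: sum.cl_ivl_Suc)
  finally show ?thesis
    unfolding T_def T0_def by (subst (1 2) sum.swap)
qed

subsection \<open>The terms involving only the parties \<open>A\<close>\<close>

lemma toric_A_part:
  fixes S :: "'p set \<Rightarrow> real"
  assumes m: "m = 2 * \<mu> + 1" and A: "cyclic_labelling A m" and S0: "S {} = 0"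
  shows "- (\<Sum>i=1..\<mu>. \<Sum>j=1..i. I3 S {A (\<mu> + j)} {A i} (block A (\<mu> + i + 1) (\<mu> - i + 1))
             (block A (i + 1) (\<mu> - i) \<union> block A (\<mu> + j + 1) (i - j)))
    - (\<Sum>j=2..\<mu>. I3 S {A (\<mu> + j)} (block A j (\<mu> - j + 1)) (block A 1 (j - 1))
             (block A (\<mu> + j + 1) (\<mu> - j + 1)))
    = (\<Sum>i=1..m. S (block A i (\<mu> + 1))) - (\<Sum>i=1..m. S (block A i \<mu>)) - S (block A 1 m)"
proof -
  interpret A: cyclic_labelling A m by fact
  define s where "s I = S (A ` I)" for I
  \<comment> \<open>Two runs of labels, either of which may be empty. In \<open>h\<close> the second
    run reaches \<open>m\<close>, because \<open>\<mu> + (\<mu> + 1) = m\<close>.\<close>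
  define g where "g i j e = s ({i..\<mu>} \<union> {\<mu> + j..\<mu> + e})" for i j e
  define h where "h i j = g i j (\<mu> + 1)" for i j
  have I3_s: "I3 S (A ` X) (A ` Y) (A ` Z) (A ` W) = I3 s X Y Z W" for X Y Z W
    by (simp add: I3_image s_def[abs_def])
  have sing: "{A i} = A ` {i}" for i by simp
  \<comment> \<open>\<open>X\<close> and \<open>Y\<close> prolong the runs in \<open>W\<close> to
    the left, and \<open>Z\<close> prolongs the second run from \<open>\<mu> + i\<close> to
    \<open>m\<close>. This gives the mixed second difference of \<open>h\<close> in \<open>i\<close>
    and \<open>j\<close>, minus that of \<open>g\<close> with right end fixed at
    \<open>i\<close>.\<close>
  have term2: "- I3 S {A (\<mu> + j)} {A i} (block A (\<mu> + i + 1) (\<mu> - i + 1))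
             (block A (i + 1) (\<mu> - i) \<union> block A (\<mu> + j + 1) (i - j))
    = (h i (Suc j) - h i j) - (h (i + 1) (Suc j) - h (i + 1) j)
      - (g i (Suc j) i - g i j i) + (g (i + 1) (Suc j) i - g (i + 1) j i)"
    if "i \<in> {1..\<mu>}" "j \<in> {1..i}" for i j
  proof -
    let ?X = "{\<mu> + j}" and ?Y = "{i}" and ?Z = "{\<mu> + i + 1..<\<mu> + i + 1 + (\<mu> - i + 1)}"
    let ?W = "{i + 1..<i + 1 + (\<mu> - i)} \<union> {\<mu> + j + 1..<\<mu> + j + 1 + (i - j)}"
    have "?X \<union> ?W = {i + 1..\<mu>} \<union> {\<mu> + j..\<mu> + i}"
      "?Y \<union> ?W = {i..\<mu>} \<union> {\<mu> + Suc j..\<mu> + i}"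
      "?Z \<union> ?W = {i + 1..\<mu>} \<union> {\<mu> + Suc j..\<mu> + (\<mu> + 1)}"
      "?X \<union> ?Y \<union> ?Z \<union> ?W = {i..\<mu>} \<union> {\<mu> + j..\<mu> + (\<mu> + 1)}"
      "?X \<union> ?Y \<union> ?W = {i..\<mu>} \<union> {\<mu> + j..\<mu> + i}"
      "?X \<union> ?Z \<union> ?W = {i + 1..\<mu>} \<union> {\<mu> + j..\<mu> + (\<mu> + 1)}"
      "?Y \<union> ?Z \<union> ?W = {i..\<mu>} \<union> {\<mu> + Suc j..\<mu> + (\<mu> + 1)}"
      "?W = {i + 1..\<mu>} \<union> {\<mu> + Suc j..\<mu> + i}"
      using that by auto
    then show ?thesis
      unfolding block_def image_Un[symmetric] sing I3_s unfolding I3_def h_def g_def by simp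
  qed
  \<comment> \<open>The unions containing \<open>Z\<close> but not \<open>Y\<close> are the blocks
    that wrap around \<open>m\<close>; all others are two runs described by
    \<open>h\<close>.\<close>
  have term3: "- I3 S {A (\<mu> + j)} (block A j (\<mu> - j + 1)) (block A 1 (j - 1))
             (block A (\<mu> + j + 1) (\<mu> - j + 1))
    = (h j j - h j (j + 1)) + (S (block A (\<mu> + j) (\<mu> + 1)) - S (block A (\<mu> + j + 1) \<mu>))
      + (h 1 (Suc j) - h 1 j) + (h (\<mu> + 1) (Suc j) - h (\<mu> + 1) j)"
    if "j \<in> {2..\<mu>}" for j
  proof -
    let ?X = "{\<mu> + j}" and ?Y = "{j..<j + (\<mu> - j + 1)}" and ?Z = "{1..<1 + (j - 1)}"
    let ?W = "{\<mu> + j + 1..<\<mu> + j + 1 + (\<mu> - j + 1)}"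
    \<comment> \<open>Periodicity relabels \<open>1\<close>, ..., \<open>j - 1\<close> as
      \<open>m + 1\<close>, ..., \<open>m + j - 1\<close>, so that \<open>Z\<close> continues
      \<open>W\<close>.\<close>
    have Z: "A ` ?Z = block A (\<mu> + j + 1 + (\<mu> - j + 1)) (j - 1)"
      using A.block_shift[of 1 "j - 1"] that m by (simp add: block_def mult_2)
    have ZW: "s (?Z \<union> ?W) = S (block A (\<mu> + j + 1) \<mu>)"
      using block_add[of A "\<mu> + j + 1" "\<mu> - j + 1" "j - 1"] that
      unfolding s_def image_Un Z by (simp add: block_def Un_commute)
    have XZW: "s (?X \<union> ?Z \<union> ?W) = S (block A (\<mu> + j) (\<mu> + 1))"
      using block_add[of A "\<mu> + j + 1" "\<mu> - j + 1" "j - 1"] insert_block[of A "\<mu> + j" \<mu>] that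
      unfolding s_def image_Un Z by (simp add: block_def Un_commute)
    have sets: "?X \<union> ?W = {\<mu> + 1..\<mu>} \<union> {\<mu> + j..\<mu> + (\<mu> + 1)}"
      "?Y \<union> ?W = {j..\<mu>} \<union> {\<mu> + (j + 1)..\<mu> + (\<mu> + 1)}"
      "?X \<union> ?Y \<union> ?Z \<union> ?W = {1..\<mu>} \<union> {\<mu> + j..\<mu> + (\<mu> + 1)}"
      "?X \<union> ?Y \<union> ?W = {j..\<mu>} \<union> {\<mu> + j..\<mu> + (\<mu> + 1)}"
      "?Y \<union> ?Z \<union> ?W = {1..\<mu>} \<union> {\<mu> + Suc j..\<mu> + (\<mu> + 1)}"
      using that by auto
    have W: "?W = {\<mu> + 1..\<mu>} \<union> {\<mu> + Suc j..\<mu> + (\<mu> + 1)}"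
      using that by auto
    show ?thesis
      unfolding block_def[of A j] block_def[of A 1] block_def[of A "\<mu> + j + 1" "\<mu> - j + 1"]
        sing I3_s
      unfolding I3_def sets ZW XZW h_def g_def using W by simp
  qed
  have S_block: "S (block A i k) = s {i..<i + k}" for i k
    by (simp add: s_def block_def)
  \<comment> \<open>At \<open>j = 1\<close> the two runs join into one block, which yields the
    blocks that do not wrap; at \<open>j = i + 1\<close> the second run is empty.\<close>
  have ends: "g i 1 i = S (block A i (\<mu> + 1))" "g (i + 1) 1 i = S (block A (i + 1) \<mu>)"
    "g i (i + 1) i = s {i..\<mu>}" "g (i + 1) (i + 1) i = s {i + 1..\<mu>}"
    if "i \<in> {1..\<mu>}" for i
    unfolding g_def S_block using that by (auto intro!: arg_cong[of _ _ s])
  have inner: "- (\<Sum>j=1..i. I3 S {A (\<mu> + j)} {A i} (block A (\<mu> + i + 1) (\<mu> - i + 1))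
             (block A (i + 1) (\<mu> - i) \<union> block A (\<mu> + j + 1) (i - j)))
    = (h i (i + 1) - h (i + 1) (i + 1)) + (h (Suc i) 1 - h i 1)
      + (s {Suc i..\<mu>} - s {i..\<mu>}) + (S (block A i (\<mu> + 1)) - S (block A (i + 1) \<mu>))"
    if i: "i \<in> {1..\<mu>}" for i
  proof -
    have "- (\<Sum>j=1..i. I3 S {A (\<mu> + j)} {A i} (block A (\<mu> + i + 1) (\<mu> - i + 1))
             (block A (i + 1) (\<mu> - i) \<union> block A (\<mu> + j + 1) (i - j)))
      = (\<Sum>j=1..i. (h i (Suc j) - h i j) - (h (i + 1) (Suc j) - h (i + 1) j)
      - (g i (Suc j) i - g i j i) + (g (i + 1) (Suc j) i - g (i + 1) j i))"
      unfolding sum_negf[symmetric] by (rule sum.cong[OF refl term2[OF i]])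
    also have "\<dots> = (h i (Suc i) - h i 1) - (h (i + 1) (Suc i) - h (i + 1) 1)
      - (g i (Suc i) i - g i 1 i) + (g (i + 1) (Suc i) i - g (i + 1) 1 i)"
    proof -
      have tele: "(\<Sum>j=1..i. f (Suc j) - f j) = f (Suc i) - f 1" for f :: "nat \<Rightarrow> real"
        by (rule sum_Suc_diff) simp
      show ?thesis
        unfolding tele[of "h i", symmetric] tele[of "h (i + 1)", symmetric]
          tele[of "\<lambda>j. g i j i", symmetric] tele[of "\<lambda>j. g (i + 1) j i", symmetric]
          sum.distrib[symmetric] sum_subtractf[symmetric] ..
    qed
    finally show ?thesis using ends[OF i] by simp
  qed
  show ?thesis
  \<comment> \<open>For \<open>\<mu> = 0\<close> the labels \<open>\<mu> + 1\<close> and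
    \<open>m\<close> coincide and the splittings used below fail. Both families are then empty, and
    the right-hand side is \<open>- S {}\<close>.\<close>
  proof (cases "\<mu> = 0")
    case True
    then show ?thesis using m S0 by (simp add: block_def)
  next
    case False
    \<comment> \<open>Only \<open>h i 1\<close> and \<open>s {i..\<mu>}\<close> telescope in
      \<open>i\<close>; the terms of \<open>h\<close> on and next to the diagonal are left for
      \<open>sum3\<close> to cancel.\<close>
    have sum2: "- (\<Sum>i=1..\<mu>. \<Sum>j=1..i. I3 S {A (\<mu> + j)} {A i} (block A (\<mu> + i + 1) (\<mu> - i + 1))
             (block A (i + 1) (\<mu> - i) \<union> block A (\<mu> + j + 1) (i - j)))
      = (\<Sum>i=1..\<mu>. h i (i + 1)) - (\<Sum>i=1..\<mu>. h (i + 1) (i + 1)) + (h (Suc \<mu>) 1 - h 1 1)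
        + (s {Suc \<mu>..\<mu>} - s {1..\<mu>})
        + ((\<Sum>i=1..\<mu>. S (block A i (\<mu> + 1))) - (\<Sum>i=1..\<mu>. S (block A (i + 1) \<mu>)))"
    proof -
      have tele: "(\<Sum>i=1..\<mu>. f (Suc i) - f i) = f (Suc \<mu>) - f 1" for f :: "nat \<Rightarrow> real"
        by (rule sum_Suc_diff) simp
      show ?thesis
        unfolding sum_negf[symmetric, of _ "{1..\<mu>}"] tele[of "\<lambda>i. h i 1", symmetric]
          tele[of "\<lambda>i. s {i..\<mu>}", symmetric] sum.distrib[symmetric] sum_subtractf[symmetric]
        by (rule sum.cong[OF refl inner])
    qed
    have sum3: "- (\<Sum>j=2..\<mu>. I3 S {A (\<mu> + j)} (block A j (\<mu> - j + 1)) (block A 1 (j - 1))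
             (block A (\<mu> + j + 1) (\<mu> - j + 1)))
      = (\<Sum>j=2..\<mu>. h j j) - (\<Sum>j=2..\<mu>. h j (j + 1))
        + ((\<Sum>j=2..\<mu>. S (block A (\<mu> + j) (\<mu> + 1))) - (\<Sum>j=2..\<mu>. S (block A (\<mu> + j + 1) \<mu>)))
        + (h 1 (Suc \<mu>) - h 1 2) + (h (\<mu> + 1) (Suc \<mu>) - h (\<mu> + 1) 2)"
    proof -
      have tele: "h i (Suc \<mu>) - h i 2 = (\<Sum>j=2..\<mu>. h i (Suc j) - h i j)" for i
        by (rule sum_Suc_diff[symmetric]) (use False in simp)
      show ?thesis
        unfolding sum_negf[symmetric] tele sum.distrib[symmetric] sum_subtractf[symmetric]
        by (rule sum.cong[OF refl term3])
    qed
    \<comment> \<open>Aligned to start at 2, the diagonal sums cancel against \<open>sum3\<close>,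
      whose telescopes also remove \<open>h 1 2\<close> and
      \<open>h (\<mu> + 1) (\<mu> + 1)\<close>. What survives of these is
      \<open>h 1 (\<mu> + 1) - h (\<mu> + 1) 2\<close>.\<close>
    have h_diag: "(\<Sum>i=1..\<mu>. h (i + 1) (i + 1)) = (\<Sum>j=2..\<mu>. h j j) + h (\<mu> + 1) (\<mu> + 1)"
      using sum.shift_bounds_cl_Suc_ivl[of "\<lambda>j. h j j" 1 \<mu>] False by (simp add: numeral_2_eq_2)
    have h_super: "(\<Sum>i=1..\<mu>. h i (i + 1)) = h 1 2 + (\<Sum>j=2..\<mu>. h j (j + 1))"
      using sum.atLeast_Suc_atMost[of 1 \<mu> "\<lambda>i. h i (i + 1)"] False by (simp add: numeral_2_eq_2)
    have h_ends: "h (Suc \<mu>) 1 = S (block A (\<mu> + 1) (\<mu> + 1))" "h 1 1 = S (block A 1 m)"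
      "h (\<mu> + 1) 2 = S (block A (\<mu> + 2) \<mu>)"
      unfolding h_def g_def S_block using m by (auto intro!: arg_cong[of _ _ s])
    have h_last: "h 1 (Suc \<mu>) = S (block A m (\<mu> + 1))"
    proof -
      have "A ` ({1..\<mu>} \<union> {m}) = insert (A m) (block A 1 \<mu>)"
        unfolding block_def by (auto simp: image_iff)
      also have "\<dots> = block A m (\<mu> + 1)"
        using insert_block[of A m \<mu>] A.block_shift[of 1 \<mu>] by (simp add: add.commute)
      finally show ?thesis
        unfolding h_def g_def s_def using m by (simp add: mult_2)
    qed
    have s_ends: "s {Suc \<mu>..\<mu>} = 0" "s {1..\<mu>} = S (block A 1 \<mu>)"
      unfolding S_block using S0 by (auto simp: s_def intro!: arg_cong[of _ _ "\<lambda>I. S (A ` I)"])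
    \<comment> \<open>Blocks of length \<open>\<mu> + 1\<close> by origin: \<open>sum2\<close>,
      \<open>h_ends\<close>, \<open>sum3\<close> and \<open>h_last\<close>.\<close>
    have split: "(\<Sum>i=1..m. f i) = (\<Sum>i=1..\<mu>. f i) + f (\<mu> + 1) + (\<Sum>j=2..\<mu>. f (\<mu> + j)) + f m"
      for f :: "nat \<Rightarrow> real"
    proof -
      have "{1..m} = {1..\<mu>} \<union> {\<mu> + 1} \<union> {2 + \<mu>..\<mu> + \<mu>} \<union> {m}" using m False by auto
      moreover have "(\<Sum>j\<in>{2 + \<mu>..\<mu> + \<mu>}. f j) = (\<Sum>j=2..\<mu>. f (\<mu> + j))"
        by (subst sum.shift_bounds_cl_nat_ivl) (simp add: add.commute)
      ultimately show ?thesis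
        using m False by (simp add: sum.union_disjoint)
    qed
    \<comment> \<open>Blocks of length \<open>\<mu>\<close> by origin, with starts shifted by one:
      \<open>s_ends\<close>, \<open>sum2\<close>, \<open>h_ends\<close> and
      \<open>sum3\<close>.\<close>
    have split': "(\<Sum>i=1..m. f i) = f 1 + (\<Sum>i=1..\<mu>. f (i + 1)) + f (\<mu> + 2) + (\<Sum>j=2..\<mu>. f (\<mu> + j + 1))"
      for f :: "nat \<Rightarrow> real"
    proof -
      have "{1..m} = {1} \<union> {1 + 1..\<mu> + 1} \<union> {\<mu> + 2} \<union> {2 + (\<mu> + 1)..\<mu> + (\<mu> + 1)}" using m False by auto
      moreover have "(\<Sum>j\<in>{2 + (\<mu> + 1)..\<mu> + (\<mu> + 1)}. f j) = (\<Sum>j=2..\<mu>. f (\<mu> + j + 1))"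
        by (subst sum.shift_bounds_cl_nat_ivl) (simp add: ac_simps)
      moreover have "(\<Sum>j\<in>{1 + 1..\<mu> + 1}. f j) = (\<Sum>j=1..\<mu>. f (j + 1))"
        by (rule sum.shift_bounds_cl_nat_ivl)
      ultimately show ?thesis
        by (simp add: sum.union_disjoint del: sum.cl_ivl_Suc)
    qed
    show ?thesis
      unfolding split[of "\<lambda>i. S (block A i (\<mu> + 1))"] split'[of "\<lambda>i. S (block A i \<mu>)"]
      using sum2 sum3 unfolding h_diag h_super h_ends h_last s_ends by simp
  qed
qed

subsection \<open>The decomposition\<close>

theorem theorem1:
  fixes A B :: "nat \<Rightarrow> 'p" and m n \<mu> \<nu> :: nat
  assumes "m = 2 * \<mu> + 1" and "n = 2 * \<nu> + 1"
    and "inj_on A {1..m}" and "inj_on B {1..n}" and "A ` {1..m} \<inter> B ` {1..n} = {}"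
    and "\<And>i. A (i + m) = A i" and "\<And>j. B (j + n) = B j"
  shows "TF_compatible (parties A m B n) (B n) (toric_Q A m B n)
    \<and> (\<forall>i\<in>{1..m}. \<forall>k\<in>{1..\<nu>}.
         TF_admissible (parties A m B n) (B n)
           {A i} {B (\<nu> + k)} (block B k (\<nu> - k + 1))
           (block A (i + 1) \<mu> \<union> block B (\<nu> + 1) (k - 1)))
    \<and> (\<forall>i\<in>{1..\<mu>}. \<forall>j\<in>{1..i}.
         TF_admissible (parties A m B n) (B n)
           {A (\<mu> + j)} {A i} (block A (\<mu> + i + 1) (\<mu> - i + 1))
           (block A (i + 1) (\<mu> - i) \<union> block A (\<mu> + j + 1) (i - j)))
    \<and> (\<forall>j\<in>{2..\<mu>}.
         TF_admissible (parties A m B n) (B n)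
           {A (\<mu> + j)} (block A j (\<mu> - j + 1)) (block A 1 (j - 1))
           (block A (\<mu> + j + 1) (\<mu> - j + 1)))
    \<and> (\<forall>S. pure_entropy (parties A m B n) S \<longrightarrow>
         toric_Q A m B n S =
           - (\<Sum>i=1..m. \<Sum>k=1..\<nu>.
                I3 S {A i} {B (\<nu> + k)} (block B k (\<nu> - k + 1))
                  (block A (i + 1) \<mu> \<union> block B (\<nu> + 1) (k - 1)))
           - (\<Sum>i=1..\<mu>. \<Sum>j=1..i.
                I3 S {A (\<mu> + j)} {A i} (block A (\<mu> + i + 1) (\<mu> - i + 1))
                  (block A (i + 1) (\<mu> - i) \<union> block A (\<mu> + j + 1) (i - j)))
           - (\<Sum>j=2..\<mu>.
                I3 S {A (\<mu> + j)} (block A j (\<mu> - j + 1)) (block A 1 (j - 1))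
                  (block A (\<mu> + j + 1) (\<mu> - j + 1))))"
proof -
  let ?P = "parties A m B n"
  interpret A: cyclic_labelling A m by unfold_locales (use assms in auto)
  interpret B: cyclic_labelling B n by unfold_locales (use assms in auto)
  have "B n \<in> B ` {1..n}" using assms(2) by simp
  then have Bn: "B n \<notin> A ` {1..m}" using assms(5) by blast
  have sing: "{A i} = A ` {i}" for i by simp
  have adm1: "TF_admissible ?P (B n) {A i} {B (\<nu> + k)} (block B k (\<nu> - k + 1))
      (block A (i + 1) \<mu> \<union> block B (\<nu> + 1) (k - 1))"
    if "i \<in> {1..m}" "k \<in> {1..\<nu>}" for i k
  proof -
    let ?Z = "{k..<k + (\<nu> - k + 1)}" and ?W = "{\<nu> + 1..<\<nu> + 1 + (k - 1)}"
    \<comment> \<open>The labels of \<open>B\<close> in use are at most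
      \<open>2 * \<nu> = n - 1\<close>, so injectivity on \<open>{1..<n}\<close> suffices and the
      purifier is avoided.\<close>
    have "TF_admissible (B ` {1..n}) (B n) (B ` {}) (B ` {\<nu> + k}) (B ` ?Z) (B ` ?W)"
    proof (rule TF_admissible_image)
      show "inj_on B {1..<n}" using assms(4) by (rule inj_on_subset) auto
      show "B ` {1..<n} \<subseteq> B ` {1..n} - {B n}"
        using inj_on_eq_iff[OF assms(4), of _ n] by auto
    qed (use that assms(2) in auto)
    moreover have "A i \<notin> block A (i + 1) \<mu>"
      using A.block_disjoint[of 1 \<mu> i] assms(1) by (simp add: block_def)
    moreover have "block A (i + 1) \<mu> \<subseteq> A ` {1..m}"
      using A.block_subset[of \<mu>] assms(1) by simp
    moreover have "A i \<in> A ` {1..m}" using that by simp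
    moreover have "B ` {\<nu> + k} = {B (\<nu> + k)}" "B ` {} = {}" by simp_all
    ultimately show ?thesis
      unfolding parties_def block_def[of B]
      using TF_admissible_extend[of "B ` {1..n}" "B n" "{B (\<nu> + k)}" "B ` ?Z" "B ` ?W"] assms(5) Bn
      by (simp only: insert_subset simp_thms)
  qed
  have A_image: "A ` {1..m} \<subseteq> ?P - {B n}" using Bn unfolding parties_def by blast
  \<comment> \<open>In the last two families all labels stay in \<open>{1..m}\<close> without
    wrapping, so disjointness can be read off the index intervals.\<close>
  have adm2: "TF_admissible ?P (B n) {A (\<mu> + j)} {A i} (block A (\<mu> + i + 1) (\<mu> - i + 1))
      (block A (i + 1) (\<mu> - i) \<union> block A (\<mu> + j + 1) (i - j))"
    if "i \<in> {1..\<mu>}" "j \<in> {1..i}" for i j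
    unfolding sing block_def image_Un[symmetric]
    by (rule TF_admissible_image[OF assms(3) _ A_image]) (use that assms(1) in auto)
  have adm3: "TF_admissible ?P (B n) {A (\<mu> + j)} (block A j (\<mu> - j + 1)) (block A 1 (j - 1))
      (block A (\<mu> + j + 1) (\<mu> - j + 1))"
    if "j \<in> {2..\<mu>}" for j
    unfolding sing block_def
    by (rule TF_admissible_image[OF assms(3) _ A_image]) (use that assms(1) in auto)
  have identity: "toric_Q A m B n S =
           - (\<Sum>i=1..m. \<Sum>k=1..\<nu>.
                I3 S {A i} {B (\<nu> + k)} (block B k (\<nu> - k + 1))
                  (block A (i + 1) \<mu> \<union> block B (\<nu> + 1) (k - 1)))
           - (\<Sum>i=1..\<mu>. \<Sum>j=1..i.
                I3 S {A (\<mu> + j)} {A i} (block A (\<mu> + i + 1) (\<mu> - i + 1))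
                  (block A (i + 1) (\<mu> - i) \<union> block A (\<mu> + j + 1) (i - j)))
           - (\<Sum>j=2..\<mu>.
                I3 S {A (\<mu> + j)} (block A j (\<mu> - j + 1)) (block A 1 (j - 1))
                  (block A (\<mu> + j + 1) (\<mu> - j + 1)))"
    if S: "pure_entropy ?P S" for S
  proof -
    have "S {} = 0" using S unfolding pure_entropy_def by simp
    note A_part = toric_A_part[of m \<mu> A S, OF assms(1) A.cyclic_labelling_axioms this]
    have half: "m div 2 = \<mu>" "n div 2 = \<nu>" using assms(1,2) by simp_all
    \<comment> \<open>The sums of \<open>S\<close> over single \<open>A\<close> blocks occur with
      opposite signs in the two parts and cancel.\<close>
    show ?thesis
      using A_part
        toric_B_part[OF assms(1,2) A.cyclic_labelling_axioms B.cyclic_labelling_axioms assms(5) S]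
      unfolding toric_Q_def half by linarith
  qed
  have "TF_compatible ?P (B n) (toric_Q A m B n)"
  \<comment> \<open>The signs are moved inside the sums so that the closure lemmas apply term by
    term.\<close>
  proof (rule TF_compatible_cong)
    show "TF_compatible ?P (B n) (\<lambda>S.
        (\<Sum>i=1..m. \<Sum>k=1..\<nu>.
           - I3 S {A i} {B (\<nu> + k)} (block B k (\<nu> - k + 1))
               (block A (i + 1) \<mu> \<union> block B (\<nu> + 1) (k - 1)))
      + (\<Sum>i=1..\<mu>. \<Sum>j=1..i.
           - I3 S {A (\<mu> + j)} {A i} (block A (\<mu> + i + 1) (\<mu> - i + 1))
               (block A (i + 1) (\<mu> - i) \<union> block A (\<mu> + j + 1) (i - j)))
      + (\<Sum>j=2..\<mu>.
           - I3 S {A (\<mu> + j)} (block A j (\<mu> - j + 1)) (block A 1 (j - 1))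
               (block A (\<mu> + j + 1) (\<mu> - j + 1))))"
      by (intro TF_compatible_add TF_compatible_sum TF_compatible_I3 adm1 adm2 adm3)
  qed (simp add: identity sum_negf)
  then show ?thesis
    using adm1 adm2 adm3 identity by blast
qed

end
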